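(* Let $G$ be an $n$-dimensional Lie group with Lie algebra $\mathfrak{g}$ and a left-invariant Riemannian metric $\mathsf{h}$, inducing the inner product $\langle\,,\rangle$ on $\mathfrak{g}$. Let $X\in\mathfrak{g}$ be a non-zero left-invariant vector field with $\|X\|=\sqrt{\langle X,X\rangle}<1$. Let $g_X$ be the left-invariant Riemannian metric on $G$ given on $\mathfrak{g}$ by $$g_X(v,z)=(1+\|X\|)\Big(\langle v,z\rangle+\frac{1}{\|X\|}\langle X,v\rangle\langle X,z\rangle\Big),$$ let $\phi:\mathfrak{g}\to\mathfrak{g}$ be the linear map with $g_X(v,z)=\langle v,\phi(z)\rangle$ for all $v,z\in\mathfrak{g}$, let $\{X_1,\dots,X_n\}$ be a $\langle\,,\rangle$-orthonormal basis of $\mathfrak{g}$ consisting of eigenvectors of $\phi$, with $\phi(X_i)=\lambda_iX_i$, and let $\alpha_{ijk}$ be the structure constants defined by $[X_i,X_j]=\sum_{k=1}^n\alpha_{ijk}X_k$. Then the Levi-Civita connection $\nabla$ of $g_X$ satisfies, for all $1\le i,j\le n$, \begin{align*} \nabla_{X_i}X_j&=\sum_{k=1}^n\frac12\Big(\frac{\lambda_i}{\lambda_k}\alpha_{kji}-\frac{\lambda_j}{\lambda_k}\alpha_{ikj}-\alpha_{jik}\Big)X_k\\ &=\sum_{k=1}^n\frac12\Big(\frac{\|X\|+\langle X,X_i\rangle^2}{\|X\|+\langle X,X_k\rangle^2}\alpha_{kji}-\frac{\|X\|+\langle X,X_j\rangle^2}{\|X\|+\langle X,X_k\rangle^2}\alpha_{ikj}-\alpha_{jik}\Big)X_k.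 \end{align*}
   Context: Elements of $\mathfrak{g}$ are identified with left-invariant vector fields on $G$. *)

theory Defs
  imports "HOL-Analysis.Analysis" "HOL-Library.Function_Algebras" "HOL-Algebra.Group"
begin

section \<open>Pointwise real vector space structure on functions\<close>

instantiation "fun" :: (type, scaleR) scaleR
begin

definition scaleR_fun :: "real \<Rightarrow> ('a \<Rightarrow> 'b) \<Rightarrow> 'a \<Rightarrow> 'b"
  where "scaleR_fun c f = (\<lambda>x. c *\<^sub>R f x)"

instance ..

end

instance "fun" :: (type, real_vector) real_vector
  by standard
    (simp_all add: scaleR_fun_def plus_fun_def scaleR_add_right scaleR_add_left fun_eq_iff)


section \<open>Smooth manifolds and smooth maps\<close>

text \<open>
  \<open>C_k_on k S f\<close> says that \<open>f\<close> is \<open>k\<close> times continuously differentiable on the open set \<open>S\<close>;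
  it is only used for open \<open>S\<close>.
\<close>

primrec C_k_on :: "nat \<Rightarrow> 'e::euclidean_space set \<Rightarrow> ('e \<Rightarrow> 'f::euclidean_space) \<Rightarrow> bool" where
  "C_k_on 0 S f \<longleftrightarrow> continuous_on S f"
| "C_k_on (Suc k) S f \<longleftrightarrow>
     (\<forall>x\<in>S. f differentiable (at x)) \<and>
     (\<forall>v. C_k_on k S (\<lambda>x. frechet_derivative f (at x) v))"

definition smooth_on :: "'e::euclidean_space set \<Rightarrow> ('e \<Rightarrow> 'f::euclidean_space) \<Rightarrow> bool"
  where "smooth_on S f \<longleftrightarrow> (\<forall>k. C_k_on k S f)"

text \<open>
  A chart is a pair \<open>(U, \<phi>)\<close> of its domain and its coordinate map with values in the model
  space \<open>'e\<close>; the values of \<open>\<phi>\<close> outside \<open>U\<close> are irrelevant, and its inverse is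
  \<open>inv_into U \<phi>\<close>. The dimension of the manifold is \<open>DIM('e)\<close>.
\<close>

record ('a, 'e) charted =
  points :: "'a topology"
  charts :: "('a set \<times> ('a \<Rightarrow> 'e)) set"

definition smooth_manifold :: "('a, 'e::euclidean_space) charted \<Rightarrow> bool" where
  "smooth_manifold M \<longleftrightarrow>
     Hausdorff_space (points M) \<and> second_countable (points M) \<and>
     (\<forall>(U, \<phi>) \<in> charts M. openin (points M) U \<and> open (\<phi> ` U) \<and>
        homeomorphic_map (subtopology (points M) U) (top_of_set (\<phi> ` U)) \<phi>) \<and>
     (\<Union>(U, \<phi>) \<in> charts M. U) = topspace (points M) \<and>
     (\<forall>(U, \<phi>) \<in> charts M. \<forall>(V, \<psi>) \<in> charts M.
        smooth_on (\<phi> ` (U \<inter> V)) (\<psi> \<circ> inv_into U \<phi>))"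

definition smooth_map ::
    "('a, 'e::euclidean_space) charted \<Rightarrow> ('b, 'f::euclidean_space) charted \<Rightarrow> ('a \<Rightarrow> 'b) \<Rightarrow> bool"
  where
  "smooth_map M N F \<longleftrightarrow>
     continuous_map (points M) (points N) F \<and>
     (\<forall>(U, \<phi>) \<in> charts M. \<forall>(V, \<psi>) \<in> charts N.
        smooth_on (\<phi> ` (U \<inter> F -` V)) (\<psi> \<circ> F \<circ> inv_into U \<phi>))"

text \<open>The open set \<open>S\<close> of a Euclidean space as a manifold with a single chart.\<close>

definition euclidean_charted :: "'e::euclidean_space set \<Rightarrow> ('e, 'e) charted" where
  "euclidean_charted S = \<lparr>points = top_of_set S, charts = {(S, \<lambda>x. x)}\<rparr>"

definition prod_charted ::
    "('a, 'e::euclidean_space) charted \<Rightarrow> ('b, 'f::euclidean_space) charted \<Rightarrow> ('a \<times> 'b, 'e \<times> 'f) charted"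
  where
  "prod_charted M N =
     \<lparr>points = prod_topology (points M) (points N),
      charts = {(U \<times> V, map_prod \<phi> \<psi>) | U \<phi> V \<psi>. (U, \<phi>) \<in> charts M \<and> (V, \<psi>) \<in> charts N}\<rparr>"

text \<open>
  Members of \<open>smooth_fun M\<close> are unconstrained outside the point set of \<open>M\<close>; tangent vectors
  below do not depend on these values.
\<close>

definition smooth_fun :: "('a, 'e::euclidean_space) charted \<Rightarrow> ('a \<Rightarrow> real) set" where
  "smooth_fun M = {f. smooth_map M (euclidean_charted (UNIV :: real set)) f}"


section \<open>Tangent vectors, vector fields and the Lie bracket\<close>

text \<open>
  A tangent vector is the directional derivative operator \<open>f \<mapsto> (f \<circ> \<gamma>)'(0)\<close> on smooth functions
  along a smooth curve \<open>\<gamma>\<close>. It is set to \<open>0\<close> on functions that are not smooth, so that equality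
  of tangent vectors is equality of functions.
\<close>

type_synonym 'a tangent = "('a \<Rightarrow> real) \<Rightarrow> real"

definition velocity :: "('a, 'e::euclidean_space) charted \<Rightarrow> (real \<Rightarrow> 'a) \<Rightarrow> 'a tangent" where
  "velocity M \<gamma> = (\<lambda>f. if f \<in> smooth_fun M then deriv (\<lambda>t. f (\<gamma> t)) 0 else 0)"

definition tangent_space :: "('a, 'e::euclidean_space) charted \<Rightarrow> 'a \<Rightarrow> 'a tangent set" where
  "tangent_space M p =
     {velocity M \<gamma> | \<gamma> \<epsilon>. \<epsilon> > 0 \<and> smooth_map (euclidean_charted {-\<epsilon><..<\<epsilon>}) M \<gamma> \<and> \<gamma> 0 = p}"

text \<open>The differential of a smooth map \<open>F : M \<rightarrow> M\<close>, applied to a tangent vector.\<close>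

definition differential ::
    "('a, 'e::euclidean_space) charted \<Rightarrow> ('a \<Rightarrow> 'a) \<Rightarrow> 'a tangent \<Rightarrow> 'a tangent" where
  "differential M F v = (\<lambda>f. if f \<in> smooth_fun M then v (\<lambda>q. f (F q)) else 0)"

text \<open>
  The function \<open>X f\<close> obtained by applying a vector field \<open>X\<close> to \<open>f\<close> is \<open>\<lambda>p. X p f\<close>. Vector
  fields are extended by \<open>0\<close> outside the point set.
\<close>

type_synonym 'a vfield = "'a \<Rightarrow> 'a tangent"

definition vector_fields :: "('a, 'e::euclidean_space) charted \<Rightarrow> 'a vfield set" where
  "vector_fields M =
     {X. (\<forall>p \<in> topspace (points M). X p \<in> tangent_space M p) \<and>
         (\<forall>p. p \<notin> topspace (points M) \<longrightarrow> X p = 0) \<and>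
         (\<forall>f \<in> smooth_fun M. (\<lambda>p. X p f) \<in> smooth_fun M)}"

definition fun_scale :: "('a \<Rightarrow> real) \<Rightarrow> 'a vfield \<Rightarrow> 'a vfield" where
  "fun_scale f X = (\<lambda>p. f p *\<^sub>R X p)"

definition lie_bracket :: "'a vfield \<Rightarrow> 'a vfield \<Rightarrow> 'a vfield" where
  "lie_bracket X Y = (\<lambda>p f. X p (\<lambda>q. Y q f) - Y p (\<lambda>q. X q f))"


section \<open>Riemannian metrics and the Levi-Civita connection\<close>

type_synonym 'a metric = "'a \<Rightarrow> 'a tangent \<Rightarrow> 'a tangent \<Rightarrow> real"

definition riemannian_metric :: "('a, 'e::euclidean_space) charted \<Rightarrow> 'a metric \<Rightarrow> bool" where
  "riemannian_metric M g \<longleftrightarrow>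
     (\<forall>p \<in> topspace (points M).
        (\<forall>u \<in> tangent_space M p. \<forall>v \<in> tangent_space M p. g p u v = g p v u) \<and>
        (\<forall>u \<in> tangent_space M p. \<forall>v \<in> tangent_space M p. \<forall>w \<in> tangent_space M p. \<forall>a b.
           g p (a *\<^sub>R u + b *\<^sub>R v) w = a * g p u w + b * g p v w) \<and>
        (\<forall>u \<in> tangent_space M p. u \<noteq> 0 \<longrightarrow> g p u u > 0)) \<and>
     (\<forall>X \<in> vector_fields M. \<forall>Y \<in> vector_fields M. (\<lambda>p. g p (X p) (Y p)) \<in> smooth_fun M)"

definition affine_connection ::
    "('a, 'e::euclidean_space) charted \<Rightarrow> ('a vfield \<Rightarrow> 'a vfield \<Rightarrow> 'a vfield) \<Rightarrow> bool" where
  "affine_connection M D \<longleftrightarrow>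
     (\<forall>X \<in> vector_fields M. \<forall>Y \<in> vector_fields M. D X Y \<in> vector_fields M) \<and>
     (\<forall>X \<in> vector_fields M. \<forall>Y \<in> vector_fields M. \<forall>Z \<in> vector_fields M.
        \<forall>f \<in> smooth_fun M. \<forall>k \<in> smooth_fun M.
        D (fun_scale f X + fun_scale k Y) Z = fun_scale f (D X Z) + fun_scale k (D Y Z)) \<and>
     (\<forall>X \<in> vector_fields M. \<forall>Y \<in> vector_fields M. \<forall>Z \<in> vector_fields M. \<forall>a b.
        D X (a *\<^sub>R Y + b *\<^sub>R Z) = a *\<^sub>R D X Y + b *\<^sub>R D X Z) \<and>
     (\<forall>X \<in> vector_fields M. \<forall>Y \<in> vector_fields M. \<forall>f \<in> smooth_fun M.
        D X (fun_scale f Y) = fun_scale (\<lambda>p. X p f) Y + fun_scale f (D X Y))"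

definition levi_civita ::
    "('a, 'e::euclidean_space) charted \<Rightarrow> 'a metric \<Rightarrow> ('a vfield \<Rightarrow> 'a vfield \<Rightarrow> 'a vfield) \<Rightarrow> bool"
  where
  "levi_civita M g D \<longleftrightarrow>
     affine_connection M D \<and>
     (\<forall>X \<in> vector_fields M. \<forall>Y \<in> vector_fields M. D X Y - D Y X = lie_bracket X Y) \<and>
     (\<forall>X \<in> vector_fields M. \<forall>Y \<in> vector_fields M. \<forall>Z \<in> vector_fields M.
        \<forall>p \<in> topspace (points M).
        X p (\<lambda>q. g q (Y q) (Z q)) = g p (D X Y p) (Z p) + g p (Y p) (D X Z p))"


section \<open>Lie groups and left-invariance\<close>

definition lie_group :: "('a, 'c) monoid_scheme \<Rightarrow> ('a, 'e::euclidean_space) charted \<Rightarrow> bool" where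
  "lie_group G M \<longleftrightarrow>
     group G \<and> smooth_manifold M \<and> carrier G = topspace (points M) \<and>
     smooth_map (prod_charted M M) M (\<lambda>(a, b). a \<otimes>\<^bsub>G\<^esub> b) \<and>
     smooth_map M M (\<lambda>a. inv\<^bsub>G\<^esub> a)"

definition lie_algebra ::
    "('a, 'c) monoid_scheme \<Rightarrow> ('a, 'e::euclidean_space) charted \<Rightarrow> 'a vfield set" where
  "lie_algebra G M =
     {X \<in> vector_fields M. \<forall>a \<in> carrier G. \<forall>p \<in> carrier G.
        X (a \<otimes>\<^bsub>G\<^esub> p) = differential M (\<lambda>q. a \<otimes>\<^bsub>G\<^esub> q) (X p)}"

definition left_invariant_metric ::
    "('a, 'c) monoid_scheme \<Rightarrow> ('a, 'e::euclidean_space) charted \<Rightarrow> 'a metric \<Rightarrow> bool" where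
  "left_invariant_metric G M g \<longleftrightarrow>
     riemannian_metric M g \<and>
     (\<forall>a \<in> carrier G. \<forall>p \<in> carrier G. \<forall>u \<in> tangent_space M p. \<forall>v \<in> tangent_space M p.
        g (a \<otimes>\<^bsub>G\<^esub> p) (differential M (\<lambda>q. a \<otimes>\<^bsub>G\<^esub> q) u) (differential M (\<lambda>q. a \<otimes>\<^bsub>G\<^esub> q) v) = g p u v)"

text \<open>The bilinear form and norm that a left-invariant metric induces on the Lie algebra.\<close>

definition lie_inner ::
    "('a, 'c) monoid_scheme \<Rightarrow> 'a metric \<Rightarrow> 'a vfield \<Rightarrow> 'a vfield \<Rightarrow> real" where
  "lie_inner G g X Y = g \<one>\<^bsub>G\<^esub> (X \<one>\<^bsub>G\<^esub>) (Y \<one>\<^bsub>G\<^esub>)"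

definition lie_norm :: "('a, 'c) monoid_scheme \<Rightarrow> 'a metric \<Rightarrow> 'a vfield \<Rightarrow> real" where
  "lie_norm G g X = sqrt (lie_inner G g X X)"

definition linear_on :: "'v::real_vector set \<Rightarrow> ('v \<Rightarrow> 'w::real_vector) \<Rightarrow> bool" where
  "linear_on V L \<longleftrightarrow>
     (\<forall>u \<in> V. \<forall>v \<in> V. \<forall>a b. L (a *\<^sub>R u + b *\<^sub>R v) = a *\<^sub>R L u + b *\<^sub>R L v)"

end

theory Submission
  imports Defs
begin

text \<open>
  The formula is the Koszul formula on a left-invariant frame. For left-invariant fields \<open>Y\<close>, \<open>Z\<close>
  and a left-invariant metric \<open>g\<close> the function \<open>g(Y, Z)\<close> is constant, so metric compatibility loses
  its derivative term: the numbers \<open>A i j k = g(\<nabla>\<^bsub>E i\<^esub> E j, E k)\<close> are skew in \<open>j, k\<close>. By torsion-freeness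
  \<open>A i j k - A j i k = g([E i, E j], E k)\<close>. These two families of linear equations determine
  \<open>A\<close> (\<open>koszul_solution\<close>). The eigenbasis \<open>E\<close> of \<open>\<phi>\<close> is orthonormal for \<open>h\<close>, hence orthogonal for
  \<open>g\<^sub>X\<close> with \<open>g\<^sub>X(E k, E k) = \<lambda>\<^sub>k\<close>; therefore \<open>g\<^sub>X([E i, E j], E k) = \<lambda>\<^sub>k \<alpha>\<^sub>i\<^sub>j\<^sub>k\<close>, and dividing \<open>A i j k\<close> by
  \<open>\<lambda>\<^sub>k\<close> gives the coefficients in the first line of the conclusion. Evaluating \<open>g\<^sub>X(E k, E k)\<close> by its definition yields
  \<open>\<lambda>\<^sub>k = (1 + |X|) / |X| (|X| + \<langle>X, E k\<rangle>\<^sup>2)\<close>, the norm and inner product being those of \<open>h\<close>. The common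
  factor cancels in the quotients, which gives the second line.

  The fields \<open>\<nabla>\<^bsub>E i\<^esub> E j\<close> are not known to be left-invariant in advance, so their expansion in the frame
  has to be justified at each point \<open>p\<close>: the values \<open>E k p\<close> must span the tangent space at \<open>p\<close>. Tangent
  vectors are operators on functions, given by curves; in a chart, each of them is the directional
  derivative along some vector of the model space
  (\<open>tangent_vector_is_coordinate_derivative\<close>). The \<open>n\<close> vectors representing the \<open>E k p\<close> are
  linearly independent because the \<open>E k p\<close> are orthonormal, so they form a basis of the
  \<open>n\<close>-dimensional model space (\<open>tangent_space_left_invariant_frame\<close>). Hence the value of
  \<open>\<nabla>\<^bsub>E i\<^esub> E j\<close> at \<open>p\<close> is also the value at \<open>p\<close> of a left-invariant field, and the
  whole computation takes place in the Lie algebra (\<open>levi_civita_left_invariant_frame\<close>).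
\<close>

section \<open>Tangent vectors in a chart\<close>

lemma smooth_on_differentiable:
  assumes "smooth_on S f" and "x \<in> S"
  shows "f differentiable (at x)"
proof -
  have "C_k_on (Suc 0) S f"
    using assms(1) unfolding smooth_on_def by blast
  then show ?thesis
    using assms(2) by simp
qed

text \<open>
  Like a velocity, this operator is \<open>0\<close> on functions that are not smooth, so that it can equal a
  tangent vector as a function.
\<close>

definition coordinate_derivative ::
    "('a, 'e::euclidean_space) charted \<Rightarrow> 'a set \<Rightarrow> ('a \<Rightarrow> 'e) \<Rightarrow> 'a \<Rightarrow> 'e \<Rightarrow> 'a tangent" where
  "coordinate_derivative M U \<psi> p w =
     (\<lambda>f. if f \<in> smooth_fun M then frechet_derivative (f \<circ> inv_into U \<psi>) (at (\<psi> p)) w else 0)"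

lemma smooth_fun_chart_differentiable:
  assumes "(U, \<psi>) \<in> charts M" and "p \<in> U" and "f \<in> smooth_fun M"
  shows "(f \<circ> inv_into U \<psi>) differentiable (at (\<psi> p))"
proof -
  have "smooth_on (\<psi> ` U) (f \<circ> inv_into U \<psi>)"
    using assms(1,3) unfolding smooth_fun_def smooth_map_def euclidean_charted_def
    by (fastforce simp: o_def)
  then show ?thesis
    using assms(2) by (auto intro: smooth_on_differentiable)
qed

lemma coordinate_derivative_linear:
  assumes "(U, \<psi>) \<in> charts M" and "p \<in> U"
  shows "linear (coordinate_derivative M U \<psi> p)"
proof (rule linearI)
  have lin: "linear (frechet_derivative (f \<circ> inv_into U \<psi>) (at (\<psi> p)))"
    if "f \<in> smooth_fun M" for f
    using smooth_fun_chart_differentiable[OF assms that] by (rule linear_frechet_derivative)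
  show "coordinate_derivative M U \<psi> p (v + w)
      = coordinate_derivative M U \<psi> p v + coordinate_derivative M U \<psi> p w" for v w
    unfolding coordinate_derivative_def
    by (auto simp: fun_eq_iff lin linear_add)
  show "coordinate_derivative M U \<psi> p (c *\<^sub>R v) = c *\<^sub>R coordinate_derivative M U \<psi> p v" for c v
    unfolding coordinate_derivative_def
    by (auto simp: fun_eq_iff lin linear_cmul scaleR_fun_def)
qed

lemma smooth_manifold_chart_at:
  assumes "smooth_manifold M" and "p \<in> topspace (points M)"
  obtains U \<psi> where "(U, \<psi>) \<in> charts M" and "p \<in> U"
  using assms unfolding smooth_manifold_def by blast

lemma smooth_manifold_chart:
  assumes "smooth_manifold M" and "(U, \<psi>) \<in> charts M"
  shows "openin (points M) U" and "inj_on \<psi> U"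
proof -
  show U: "openin (points M) U"
    using assms unfolding smooth_manifold_def by blast
  have "homeomorphic_map (subtopology (points M) U) (top_of_set (\<psi> ` U)) \<psi>"
    using assms unfolding smooth_manifold_def by blast
  then have "inj_on \<psi> (topspace (subtopology (points M) U))"
    by (simp add: homeomorphic_map_def)
  moreover have "topspace (subtopology (points M) U) = U"
    using openin_subset[OF U] by auto
  ultimately show "inj_on \<psi> U" by simp
qed

text \<open>
  The chain rule: the direction \<open>w\<close> is the velocity at \<open>0\<close> of the curve read in the chart. This bounds the
  tangent space from above by the model space; a frame of fields bounds it from below.
\<close>

lemma tangent_vector_is_coordinate_derivative:
  assumes M: "smooth_manifold M" and ch: "(U, \<psi>) \<in> charts M" and p: "p \<in> U"
    and u: "u \<in> tangent_space M p"
  shows "\<exists>w. u = coordinate_derivative M U \<psi> p w"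
proof -
  obtain \<gamma> \<epsilon> where u_eq: "u = velocity M \<gamma>" and eps: "\<epsilon> > 0"
    and sm: "smooth_map (euclidean_charted {-\<epsilon><..<\<epsilon>}) M \<gamma>" and g0: "\<gamma> 0 = p"
    using u unfolding tangent_space_def by blast
  \<comment> \<open>The chart sees the curve only while it stays in \<open>U\<close>, that is, on the open set \<open>T\<close> of times.\<close>
  define S where "S = {-\<epsilon><..<\<epsilon>}"
  define T where "T = {t \<in> S. \<gamma> t \<in> U}"
  have openS: "open S" and S0: "0 \<in> S"
    using eps by (auto simp: S_def)
  have cont: "continuous_map (top_of_set S) (points M) \<gamma>"
    using sm by (simp add: smooth_map_def euclidean_charted_def S_def)
  have "openin (top_of_set S) T"
    using openin_continuous_map_preimage[OF cont smooth_manifold_chart(1)[OF M ch]]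
    by (simp add: T_def)
  then have openT: "open T"
    using openS openin_open_trans by blast
  have T0: "0 \<in> T"
    using S0 p g0 by (simp add: T_def)
  have "smooth_on T (\<psi> \<circ> \<gamma> \<circ> inv_into S (\<lambda>x. x))"
  proof -
    have "T = (\<lambda>x. x) ` (S \<inter> \<gamma> -` U)" by (auto simp: T_def)
    then show ?thesis
      using sm ch unfolding smooth_map_def euclidean_charted_def S_def by fastforce
  qed
  then have diff: "(\<psi> \<circ> \<gamma> \<circ> inv_into S (\<lambda>x. x)) differentiable (at 0)"
    using T0 by (rule smooth_on_differentiable)
  \<comment> \<open>The identity chart of the interval enters through its inverse, which is the identity on \<open>S\<close> only.\<close>
  then obtain c' where "((\<psi> \<circ> \<gamma> \<circ> inv_into S (\<lambda>x. x)) has_derivative c') (at 0)"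
    unfolding differentiable_def by blast
  then have c': "((\<psi> \<circ> \<gamma>) has_derivative c') (at 0)"
  proof (rule has_derivative_transform_within_open[OF _ openS S0])
    fix t assume "t \<in> S"
    then have "inv_into S (\<lambda>x. x) t = t"
      using inv_into_f_f[of "\<lambda>x. x" S t] by (simp add: inj_on_def)
    then show "(\<psi> \<circ> \<gamma> \<circ> inv_into S (\<lambda>x. x)) t = (\<psi> \<circ> \<gamma>) t" by simp
  qed
  have "u f = coordinate_derivative M U \<psi> p (c' 1) f" for f
  proof (cases "f \<in> smooth_fun M")
    case True
    define F where "F = f \<circ> inv_into U \<psi>"
    define F' where "F' = frechet_derivative F (at (\<psi> p))"
    have F': "(F has_derivative F') (at ((\<psi> \<circ> \<gamma>) 0))"
      using smooth_fun_chart_differentiable[OF ch p True] g0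
      by (simp add: F_def F'_def frechet_derivative_works)
    have "(F \<circ> (\<psi> \<circ> \<gamma>) has_derivative F' \<circ> c') (at 0)"
      using diff_chain_at[OF c' F'] .
    then have "((\<lambda>t. f (\<gamma> t)) has_derivative F' \<circ> c') (at 0)"
    proof (rule has_derivative_transform_within_open[OF _ openT T0])
      fix t assume "t \<in> T"
      then show "(F \<circ> (\<psi> \<circ> \<gamma>)) t = f (\<gamma> t)"
        using smooth_manifold_chart(2)[OF M ch] by (simp add: F_def T_def)
    qed
    then have d: "((\<lambda>t. f (\<gamma> t)) has_derivative F' \<circ> c') (at 0)" .
    then have lin: "linear (F' \<circ> c')" by (rule has_derivative_linear)
    have "F' \<circ> c' = (*) (F' (c' 1))"
    proof
      fix t
      show "(F' \<circ> c') t = F' (c' 1) * t"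
        using linear_cmul[OF lin, of t 1] by (simp add: mult.commute)
    qed
    then have "((\<lambda>t. f (\<gamma> t)) has_field_derivative F' (c' 1)) (at 0)"
      using d by (simp add: has_field_derivative_def)
    then have "deriv (\<lambda>t. f (\<gamma> t)) 0 = F' (c' 1)"
      by (rule DERIV_imp_deriv)
    then show ?thesis
      using True by (simp add: u_eq velocity_def coordinate_derivative_def F'_def F_def)
  next
    case False
    then show ?thesis by (simp add: u_eq velocity_def coordinate_derivative_def)
  qed
  then show ?thesis by blast
qed

text \<open>
  Metric functions such as \<open>\<lambda>q. g q (Y q) (Z q)\<close> are controlled on the point set only, so constancy
  is required only there; the curve stays in that set near time \<open>0\<close>.
\<close>

lemma tangent_vector_constant:
  assumes u: "u \<in> tangent_space M p" and f: "\<And>q. q \<in> topspace (points M) \<Longrightarrow> f q = c"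
  shows "u f = 0"
proof -
  obtain \<gamma> \<epsilon> where u_eq: "u = velocity M \<gamma>" and eps: "\<epsilon> > 0"
    and sm: "smooth_map (euclidean_charted {-\<epsilon><..<\<epsilon>}) M \<gamma>"
    using u unfolding tangent_space_def by blast
  have cont: "continuous_map (top_of_set {-\<epsilon><..<\<epsilon>}) (points M) \<gamma>"
    using sm by (simp add: smooth_map_def euclidean_charted_def)
  have "((\<lambda>t. f (\<gamma> t)) has_field_derivative 0) (at 0)"
  proof (rule has_field_derivative_transform_within_open[of "\<lambda>_. c" _ _ "{-\<epsilon><..<\<epsilon>}"])
    fix t assume "t \<in> {-\<epsilon><..<\<epsilon>}"
    then show "c = f (\<gamma> t)"
      using continuous_map_funspace[OF cont] f by fastforce
  qed (use eps in auto)
  then show ?thesis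
    by (simp add: u_eq velocity_def DERIV_imp_deriv)
qed


section \<open>Left-invariant fields and metrics\<close>

lemma lie_algebra_tangent:
  assumes "Y \<in> lie_algebra G M" and "p \<in> topspace (points M)"
  shows "Y p \<in> tangent_space M p"
  using assms unfolding lie_algebra_def vector_fields_def by blast

lemma lie_algebra_vector_fields: "lie_algebra G M \<subseteq> vector_fields M"
  unfolding lie_algebra_def by blast

lemma vector_field_value:
  "Y \<in> vector_fields M \<Longrightarrow> p \<in> topspace (points M) \<Longrightarrow> Y p \<in> tangent_space M p"
  unfolding vector_fields_def by blast

lemma vector_field_eq_zero_outside:
  "Y \<in> vector_fields M \<Longrightarrow> p \<notin> topspace (points M) \<Longrightarrow> Y p = 0"
  unfolding vector_fields_def by blast

lemma one_in_points:
  "group G \<Longrightarrow> carrier G = topspace (points M) \<Longrightarrow> \<one>\<^bsub>G\<^esub> \<in> topspace (points M)"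
  by (metis group.is_monoid monoid.one_closed)

lemma lie_algebra_value_at_one:
  assumes "group G" and "carrier G = topspace (points M)" and "Y \<in> lie_algebra G M"
    and "p \<in> topspace (points M)"
  shows "Y p = differential M (\<lambda>q. p \<otimes>\<^bsub>G\<^esub> q) (Y \<one>\<^bsub>G\<^esub>)"
proof -
  have "\<one>\<^bsub>G\<^esub> \<in> carrier G" "p \<otimes>\<^bsub>G\<^esub> \<one>\<^bsub>G\<^esub> = p"
    using assms one_in_points[OF assms(1,2)] group.is_monoid[OF assms(1)]
    by (simp_all add: monoid.r_one)
  then show ?thesis
    using assms unfolding lie_algebra_def by (metis (mono_tags, lifting) mem_Collect_eq)
qed

text \<open>
  Translation by \<open>p\<close> carries the values at the identity to the values at \<open>p\<close>. This is what removes
  the derivative terms from the Koszul formula.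
\<close>

lemma left_invariant_metric_constant:
  assumes "group G" and "carrier G = topspace (points M)" and "left_invariant_metric G M g"
    and "Y \<in> lie_algebra G M" and "Z \<in> lie_algebra G M" and "p \<in> topspace (points M)"
  shows "g p (Y p) (Z p) = lie_inner G g Y Z"
proof -
  have one: "\<one>\<^bsub>G\<^esub> \<in> carrier G" "p \<otimes>\<^bsub>G\<^esub> \<one>\<^bsub>G\<^esub> = p"
    using assms one_in_points[OF assms(1,2)] group.is_monoid[OF assms(1)]
    by (simp_all add: monoid.r_one)
  have "Y \<one>\<^bsub>G\<^esub> \<in> tangent_space M \<one>\<^bsub>G\<^esub>" "Z \<one>\<^bsub>G\<^esub> \<in> tangent_space M \<one>\<^bsub>G\<^esub>"
    using assms one by (auto intro: lie_algebra_tangent)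
  then have "g (p \<otimes>\<^bsub>G\<^esub> \<one>\<^bsub>G\<^esub>) (differential M (\<lambda>q. p \<otimes>\<^bsub>G\<^esub> q) (Y \<one>\<^bsub>G\<^esub>))
      (differential M (\<lambda>q. p \<otimes>\<^bsub>G\<^esub> q) (Z \<one>\<^bsub>G\<^esub>)) = lie_inner G g Y Z"
    using assms(2,3,6) one(1) unfolding left_invariant_metric_def lie_inner_def by blast
  then show ?thesis
    using lie_algebra_value_at_one[OF assms(1,2)] assms(4,5,6) one(2) by simp
qed

lemma riemannian_metric_comb:
  assumes "riemannian_metric M g" and "p \<in> topspace (points M)"
    and "u \<in> tangent_space M p" and "v \<in> tangent_space M p" and "w \<in> tangent_space M p"
  shows "g p (a *\<^sub>R u + b *\<^sub>R v) w = a * g p u w + b * g p v w"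
  using assms unfolding riemannian_metric_def by blast

lemma riemannian_metric_sym:
  assumes "riemannian_metric M g" and "p \<in> topspace (points M)"
    and "u \<in> tangent_space M p" and "v \<in> tangent_space M p"
  shows "g p u v = g p v u"
  using assms unfolding riemannian_metric_def by blast

lemma lie_inner_comb:
  assumes "group G" and "carrier G = topspace (points M)" and "riemannian_metric M g"
    and "Y \<in> lie_algebra G M" and "Y' \<in> lie_algebra G M" and "Z \<in> lie_algebra G M"
  shows "lie_inner G g (a *\<^sub>R Y + b *\<^sub>R Y') Z = a * lie_inner G g Y Z + b * lie_inner G g Y' Z"
  using riemannian_metric_comb[OF assms(3), of "\<one>\<^bsub>G\<^esub>" "Y \<one>\<^bsub>G\<^esub>" "Y' \<one>\<^bsub>G\<^esub>" "Z \<one>\<^bsub>G\<^esub>" a b]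
    one_in_points[OF assms(1,2)] assms(4,5,6)
  by (simp add: lie_inner_def scaleR_fun_def lie_algebra_tangent)

lemma lie_inner_sym:
  assumes "group G" and "carrier G = topspace (points M)" and "riemannian_metric M g"
    and "Y \<in> lie_algebra G M" and "Z \<in> lie_algebra G M"
  shows "lie_inner G g Y Z = lie_inner G g Z Y"
  using riemannian_metric_sym[OF assms(3)] one_in_points[OF assms(1,2)] assms(4,5)
    lie_algebra_tangent
  by (metis lie_inner_def)

text \<open>
  A left-invariant field that vanishes at the identity vanishes everywhere, so positivity of \<open>g\<close> at the
  identity suffices.
\<close>

lemma lie_inner_pos:
  assumes "group G" and "carrier G = topspace (points M)" and "riemannian_metric M g"
    and "Y \<in> lie_algebra G M" and "Y \<noteq> 0"
  shows "lie_inner G g Y Y > 0"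
proof -
  have "Y \<one>\<^bsub>G\<^esub> \<noteq> 0"
  proof
    assume "Y \<one>\<^bsub>G\<^esub> = 0"
    then have "Y p = 0" for p
      using lie_algebra_value_at_one[OF assms(1,2,4), of p] assms(4) lie_algebra_vector_fields
        vector_field_eq_zero_outside[of Y M p]
      by (cases "p \<in> topspace (points M)") (auto simp: differential_def fun_eq_iff)
    then show False using \<open>Y \<noteq> 0\<close> by auto
  qed
  then show ?thesis
    using assms(3) one_in_points[OF assms(1,2)] lie_algebra_tangent[OF assms(4)]
    unfolding riemannian_metric_def lie_inner_def by blast
qed

text \<open>
  The subspace hypothesis puts the partial sums into the Lie algebra; their values are then tangent
  vectors, on which \<open>g\<close> is bilinear.
\<close>

lemma lie_inner_sum:
  assumes "group G" and "carrier G = topspace (points M)" and "riemannian_metric M g"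
    and "subspace (lie_algebra G M)" and "\<And>k. k \<in> I \<Longrightarrow> F k \<in> lie_algebra G M"
    and "Z \<in> lie_algebra G M" and "finite I"
  shows "lie_inner G g (\<Sum>k\<in>I. c k *\<^sub>R F k) Z = (\<Sum>k\<in>I. c k * lie_inner G g (F k) Z)"
  using \<open>finite I\<close> assms(5)
proof (induction I rule: finite_induct)
  case empty
  have "lie_inner G g 0 Z = 0"
    using lie_inner_comb[OF assms(1-3) assms(6,6,6), of 0 0] by simp
  then show ?case by (simp only: sum.empty)
next
  case (insert i I)
  have "(\<Sum>k\<in>I. c k *\<^sub>R F k) \<in> lie_algebra G M"
    using insert.prems by (intro subspace_sum[OF assms(4)] subspace_scale[OF assms(4)]) auto
  then have "lie_inner G g (c i *\<^sub>R F i + (\<Sum>k\<in>I. c k *\<^sub>R F k)) Z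
      = c i * lie_inner G g (F i) Z + (\<Sum>k\<in>I. c k * lie_inner G g (F k) Z)"
    using insert lie_inner_comb[OF assms(1-3), of "F i" "\<Sum>k\<in>I. c k *\<^sub>R F k" Z "c i" 1] assms(6)
    by simp
  then show ?case
    unfolding sum.insert[OF insert.hyps] .
qed

lemma sum_fields_apply:
  fixes F :: "'i \<Rightarrow> 'a vfield"
  shows "(\<Sum>k\<in>I. c k *\<^sub>R F k) p = (\<Sum>k\<in>I. c k *\<^sub>R F k p)"
  by (induction I rule: infinite_finite_induct) (auto simp: scaleR_fun_def)

text \<open>
  Represent each \<open>E k p\<close> by a direction \<open>w k\<close> in a chart. A linear relation between the \<open>w k\<close> gives the
  same relation between the \<open>E k p\<close>, and pairing it with \<open>E j p\<close> shows that all coefficients vanish.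
  So the \<open>w k\<close> are \<open>DIM('e)\<close> independent vectors of \<open>'e\<close>, hence a basis, and the direction of \<open>u\<close>
  is a combination of them. The same combination of the fields \<open>E k\<close> is the required \<open>Y\<close>.
\<close>

lemma tangent_space_left_invariant_frame:
  fixes M :: "('a, 'e::euclidean_space) charted"
  assumes "group G" and "carrier G = topspace (points M)" and M: "smooth_manifold M"
    and h: "left_invariant_metric G M h" and sub: "subspace (lie_algebra G M)"
    and E: "\<And>k. k \<in> I \<Longrightarrow> E k \<in> lie_algebra G M"
    and orth: "\<And>j k. j \<in> I \<Longrightarrow> k \<in> I \<Longrightarrow> lie_inner G h (E j) (E k) = (if j = k then 1 else 0)"
    and "finite I" and card: "card I = DIM('e)"
    and p: "p \<in> topspace (points M)" and u: "u \<in> tangent_space M p"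
  shows "\<exists>Y \<in> lie_algebra G M. u = Y p"
proof -
  have riem: "riemannian_metric M h"
    using h unfolding left_invariant_metric_def by blast
  obtain U \<psi> where ch: "(U, \<psi>) \<in> charts M" "p \<in> U"
    using smooth_manifold_chart_at[OF M p] .
  define L where "L = coordinate_derivative M U \<psi> p"
  have linL: "linear L"
    unfolding L_def using ch by (rule coordinate_derivative_linear)
  have "\<forall>k\<in>I. \<exists>w. E k p = L w"
    using tangent_vector_is_coordinate_derivative[OF M ch] lie_algebra_tangent[OF E p]
    unfolding L_def by blast
  then obtain w where w: "\<And>k. k \<in> I \<Longrightarrow> E k p = L (w k)"
    by metis
  have comb: "(\<Sum>k\<in>I. a k *\<^sub>R E k) \<in> lie_algebra G M" for a
    using E by (intro subspace_sum[OF sub] subspace_scale[OF sub]) auto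
  have L_comb: "L (\<Sum>k\<in>I. a k *\<^sub>R w k) = (\<Sum>k\<in>I. a k *\<^sub>R E k) p" for a
    using w by (simp add: sum_fields_apply linear_sum[OF linL] linear_cmul[OF linL])
  \<comment> \<open>Stated for families instead of sets, so that it also yields the injectivity of \<open>w\<close> below.\<close>
  have zero: "a j = 0" if "(\<Sum>k\<in>I. a k *\<^sub>R w k) = 0" and j: "j \<in> I" for a j
  proof -
    have "(\<Sum>k\<in>I. a k *\<^sub>R E k) p = 0"
      using L_comb[of a] that(1) linear_0[OF linL] by simp
    then have "h p ((\<Sum>k\<in>I. a k *\<^sub>R E k) p) (E j p) = 0"
      using riemannian_metric_comb[OF riem p, of "E j p" "E j p" "E j p" 0 0]
        lie_algebra_tangent[OF E[OF j] p] by simp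
    then have "(\<Sum>k\<in>I. a k * lie_inner G h (E k) (E j)) = 0"
      using left_invariant_metric_constant[OF assms(1,2) h comb E[OF j] p]
        lie_inner_sum[OF assms(1,2) riem sub E E[OF j] \<open>finite I\<close>] by simp
    then show "a j = 0"
      using orth j \<open>finite I\<close> by (simp add: if_distrib sum.delta cong: if_cong)
  qed
  have inj: "inj_on w I"
  proof (rule inj_onI, rule ccontr)
    fix i j assume ij: "i \<in> I" "j \<in> I" "w i = w j" "i \<noteq> j"
    let ?a = "\<lambda>k. (if k = i then 1 else 0) - (if k = j then 1 else 0) :: real"
    have "(\<Sum>k\<in>I. ?a k *\<^sub>R w k) = 0"
      using ij \<open>finite I\<close>
      by (simp add: scaleR_left_diff_distrib sum_subtractf if_distrib[of "\<lambda>x. x *\<^sub>R _"]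
          cong: if_cong)
    from zero[OF this \<open>i \<in> I\<close>] show False
      using ij by simp
  qed
  have "independent (w ` I)"
  proof (rule independent_if_scalars_zero)
    fix a v assume "(\<Sum>v\<in>w ` I. a v *\<^sub>R v) = 0" and "v \<in> w ` I"
    then show "a v = 0"
      using zero[of "\<lambda>k. a (w k)"] by (auto simp: sum.reindex[OF inj] o_def)
  qed (use \<open>finite I\<close> in simp)
  then have span: "span (w ` I) = UNIV"
    using card_ge_dim_independent[of "w ` I" UNIV] card inj
    by (auto simp: card_image)
  obtain x where x: "u = L x"
    using tangent_vector_is_coordinate_derivative[OF M ch u] unfolding L_def by blast
  obtain b where "x = (\<Sum>v\<in>w ` I. b v *\<^sub>R v)"
    using span \<open>finite I\<close> span_finite[of "w ` I"] by auto
  then have "x = (\<Sum>k\<in>I. b (w k) *\<^sub>R w k)"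
    by (simp add: sum.reindex[OF inj])
  then have "u = (\<Sum>k\<in>I. b (w k) *\<^sub>R E k) p"
    using x L_comb[of "\<lambda>k. b (w k)"] by simp
  then show ?thesis using comb by (rule bexI)
qed


section \<open>The Levi-Civita connection\<close>

text \<open>
  The classical cyclic argument: in the alternating sum of the three torsion equations for \<open>i, j, k\<close>,
  skewness cancels everything except twice \<open>A i j k\<close>.
\<close>

lemma koszul_solution:
  fixes A T :: "'i \<Rightarrow> 'i \<Rightarrow> 'i \<Rightarrow> real"
  assumes skew: "\<And>i j k. i \<in> I \<Longrightarrow> j \<in> I \<Longrightarrow> k \<in> I \<Longrightarrow> A i j k + A i k j = 0"
    and torsion: "\<And>i j k. i \<in> I \<Longrightarrow> j \<in> I \<Longrightarrow> k \<in> I \<Longrightarrow> A i j k - A j i k = T i j k"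
    and "i \<in> I" and "j \<in> I" and "k \<in> I"
  shows "A i j k = (T k j i - T i k j - T j i k) / 2"
  using skew[of i j k] skew[of j i k] skew[of k i j]
    torsion[of k j i] torsion[of i k j] torsion[of j i k] assms(3-5)
  by simp

lemma levi_civita_vector_field:
  assumes "levi_civita M g nabla" and "Y \<in> vector_fields M" and "Z \<in> vector_fields M"
  shows "nabla Y Z \<in> vector_fields M"
  using assms unfolding levi_civita_def affine_connection_def by simp

lemma levi_civita_torsion_free:
  assumes "levi_civita M g nabla" and "Y \<in> vector_fields M" and "Z \<in> vector_fields M"
  shows "nabla Y Z - nabla Z Y = lie_bracket Y Z"
  using assms unfolding levi_civita_def by simp

lemma levi_civita_metric:
  assumes "levi_civita M g nabla" and "X \<in> vector_fields M" and "Y \<in> vector_fields M"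
    and "Z \<in> vector_fields M" and "p \<in> topspace (points M)"
  shows "X p (\<lambda>q. g q (Y q) (Z q)) = g p (nabla X Y p) (Z p) + g p (Y p) (nabla X Z p)"
  using assms unfolding levi_civita_def by blast

text \<open>
  At a fixed point \<open>p\<close> the field \<open>D a b\<close> is the left-invariant field with the same value as
  \<open>nabla (E a) (E b)\<close>. Both connection axioms then become linear equations for the numbers
  \<open>lie_inner G g (D a b) (E c)\<close>, whose solution does not depend on \<open>p\<close>, and the coefficients of
  \<open>D a b\<close> in the frame are these numbers divided by \<open>lam c\<close>.
\<close>

lemma levi_civita_left_invariant_frame:
  fixes M :: "('a, 'e::euclidean_space) charted"
  assumes G: "lie_group G M" and g: "left_invariant_metric G M g"
    and sub: "subspace (lie_algebra G M)"
    and E: "\<And>k. k \<in> I \<Longrightarrow> E k \<in> lie_algebra G M"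
    and orth: "\<And>j k. j \<in> I \<Longrightarrow> k \<in> I \<Longrightarrow> lie_inner G g (E j) (E k) = (if j = k then lam k else 0)"
    and lam: "\<And>k. k \<in> I \<Longrightarrow> lam k \<noteq> 0"
    and "finite I"
    and span: "span (E ` I) = lie_algebra G M"
    and ext: "\<And>p u. p \<in> topspace (points M) \<Longrightarrow> u \<in> tangent_space M p
        \<Longrightarrow> \<exists>Y \<in> lie_algebra G M. u = Y p"
    and struct: "\<And>i j. i \<in> I \<Longrightarrow> j \<in> I \<Longrightarrow> lie_bracket (E i) (E j) = (\<Sum>k\<in>I. \<alpha> i j k *\<^sub>R E k)"
    and LC: "levi_civita M g nabla"
    and "i \<in> I" and "j \<in> I"
  shows "nabla (E i) (E j) = (\<Sum>k\<in>I. (1 / 2 *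
      (lam i / lam k * \<alpha> k j i - lam j / lam k * \<alpha> i k j - \<alpha> j i k)) *\<^sub>R E k)"
proof
  have grp: "group G" and car: "carrier G = topspace (points M)"
    using G unfolding lie_group_def by blast+
  have riem: "riemannian_metric M g"
    using g unfolding left_invariant_metric_def by blast
  have conn: "nabla Y Z \<in> vector_fields M" if "Y \<in> lie_algebra G M" "Z \<in> lie_algebra G M" for Y Z
    using LC subsetD[OF lie_algebra_vector_fields that(1)] subsetD[OF lie_algebra_vector_fields that(2)]
    by (rule levi_civita_vector_field)
  have E_field: "E k \<in> vector_fields M" if "k \<in> I" for k
    using lie_algebra_vector_fields E[OF that] by (rule subsetD)
  have comb: "(\<Sum>k\<in>I. a k *\<^sub>R E k) \<in> lie_algebra G M" for a
    using E by (intro subspace_sum[OF sub] subspace_scale[OF sub]) auto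
  have inner_comb: "lie_inner G g (\<Sum>k\<in>I. a k *\<^sub>R E k) (E c) = a c * lam c" if "c \<in> I" for a c
  proof -
    have "lie_inner G g (\<Sum>k\<in>I. a k *\<^sub>R E k) (E c) = (\<Sum>k\<in>I. a k * lie_inner G g (E k) (E c))"
      using grp car riem sub E E[OF that] \<open>finite I\<close> by (rule lie_inner_sum)
    also have "\<dots> = (\<Sum>k\<in>I. if k = c then a k * lam k else 0)"
      using orth that by (intro sum.cong) auto
    also have "\<dots> = a c * lam c"
      using that \<open>finite I\<close> by simp
    finally show ?thesis .
  qed
  \<comment> \<open>Needed to turn sums over the set \<open>E ` I\<close>, which the span provides, into sums over indices.\<close>
  have inj: "inj_on E I"
  proof (rule inj_onI, rule ccontr)
    fix a b assume "a \<in> I" "b \<in> I" "E a = E b" "a \<noteq> b"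
    then show False using orth[of a b] orth[of b b] lam[of b] by simp
  qed
  fix p
  let ?R = "\<Sum>k\<in>I. (1 / 2 *
      (lam i / lam k * \<alpha> k j i - lam j / lam k * \<alpha> i k j - \<alpha> j i k)) *\<^sub>R E k"
  show "nabla (E i) (E j) p = ?R p"
  proof (cases "p \<in> topspace (points M)")
    case False
    have "?R p = 0"
      using subsetD[OF lie_algebra_vector_fields comb] False by (rule vector_field_eq_zero_outside)
    moreover have "nabla (E i) (E j) p = 0"
      using conn[OF E[OF \<open>i \<in> I\<close>] E[OF \<open>j \<in> I\<close>]] False by (rule vector_field_eq_zero_outside)
    ultimately show ?thesis by (simp only:)
  next
    case True
    have const: "g q (Y q) (Z q) = lie_inner G g Y Z"
      if "Y \<in> lie_algebra G M" "Z \<in> lie_algebra G M" "q \<in> topspace (points M)" for Y Z q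
      using grp car g that by (rule left_invariant_metric_constant)
    define D where "D a b = (SOME Y. Y \<in> lie_algebra G M \<and> nabla (E a) (E b) p = Y p)" for a b
    have D_ext: "D a b \<in> lie_algebra G M \<and> nabla (E a) (E b) p = D a b p"
      if "a \<in> I" "b \<in> I" for a b
      using ext[OF True vector_field_value[OF conn[OF E[OF that(1)] E[OF that(2)]] True]]
      unfolding D_def Bex_def by (rule someI_ex)
    note D = D_ext[THEN conjunct1] and Dp = D_ext[THEN conjunct2]
    define A where "A a b c = lie_inner G g (D a b) (E c)" for a b c
    have skew: "A a b c + A a c b = 0" if "a \<in> I" "b \<in> I" "c \<in> I" for a b c
    proof -
      have "E a p (\<lambda>q. g q (E b q) (E c q)) = 0"
        by (rule tangent_vector_constant[OF lie_algebra_tangent[OF E[OF \<open>a \<in> I\<close>] True]])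
          (rule const[OF E[OF \<open>b \<in> I\<close>] E[OF \<open>c \<in> I\<close>]])
      moreover have "E a p (\<lambda>q. g q (E b q) (E c q))
          = g p (nabla (E a) (E b) p) (E c p) + g p (E b p) (nabla (E a) (E c) p)"
        using LC E_field[OF \<open>a \<in> I\<close>] E_field[OF \<open>b \<in> I\<close>] E_field[OF \<open>c \<in> I\<close>] True
        by (rule levi_civita_metric)
      ultimately have "g p (D a b p) (E c p) + g p (E b p) (D a c p) = 0"
        using Dp that by simp
      then show ?thesis
        unfolding A_def const[OF D[OF that(1,2)] E[OF that(3)] True]
          const[OF E[OF that(2)] D[OF that(1,3)] True]
          lie_inner_sym[OF grp car riem E[OF that(2)] D[OF that(1,3)]] .
    qed
    have torsion: "A a b c - A b a c = \<alpha> a b c * lam c" if "a \<in> I" "b \<in> I" "c \<in> I" for a b c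
    proof -
      let ?B = "\<Sum>k\<in>I. \<alpha> a b k *\<^sub>R E k" and ?D = "1 *\<^sub>R D a b + (- 1) *\<^sub>R D b a"
      have "nabla (E a) (E b) - nabla (E b) (E a) = ?B"
        using levi_civita_torsion_free[OF LC E_field E_field] struct that by simp
      from fun_cong[OF this, of p] have eq: "?D p = ?B p"
        using Dp[OF that(1,2)] Dp[OF that(2,1)] by simp
      have D_in: "?D \<in> lie_algebra G M"
        using D that by (intro subspace_add[OF sub] subspace_scale[OF sub])
      have "lie_inner G g ?D (E c) = lie_inner G g ?B (E c)"
        unfolding const[OF D_in E[OF that(3)] True, symmetric]
          const[OF comb E[OF that(3)] True, symmetric] eq ..
      then show ?thesis
        using lie_inner_comb[OF grp car riem D[OF that(1,2)] D[OF that(2,1)] E[OF that(3)], of 1 "- 1"]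
          inner_comb[OF that(3), of "\<alpha> a b"]
        unfolding A_def by linarith
    qed
    have A: "A i j k = (\<alpha> k j i * lam i - \<alpha> i k j * lam j - \<alpha> j i k * lam k) / 2" if "k \<in> I" for k
      using skew torsion \<open>i \<in> I\<close> \<open>j \<in> I\<close> that by (rule koszul_solution)
    obtain b where "D i j = (\<Sum>v\<in>E ` I. b v *\<^sub>R v)"
      using D[OF \<open>i \<in> I\<close> \<open>j \<in> I\<close>] span \<open>finite I\<close> span_finite[of "E ` I"] by auto
    then have Db: "D i j = (\<Sum>k\<in>I. b (E k) *\<^sub>R E k)"
      by (simp add: sum.reindex[OF inj])
    have "b (E k) = 1 / 2 * (lam i / lam k * \<alpha> k j i - lam j / lam k * \<alpha> i k j - \<alpha> j i k)"
      if "k \<in> I" for k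
    proof -
      have "b (E k) * lam k = A i j k"
        using inner_comb[OF that, of "\<lambda>k. b (E k)"] Db by (simp add: A_def)
      then show ?thesis
        using A[OF that] lam[OF that] by (simp add: field_simps)
    qed
    then have "D i j = ?R"
      unfolding Db by (intro sum.cong) auto
    then show ?thesis
      using Dp \<open>i \<in> I\<close> \<open>j \<in> I\<close> by simp
  qed
qed



theorem proposition2p2:
  fixes G :: "('a, 'c) monoid_scheme"
    and M :: "('a, 'e::euclidean_space) charted"
    and n :: nat
    and h gX :: "'a metric"
    and X :: "'a vfield"
    and \<phi> :: "'a vfield \<Rightarrow> 'a vfield"
    and E :: "nat \<Rightarrow> 'a vfield"
    and lam :: "nat \<Rightarrow> real"
    and \<alpha> :: "nat \<Rightarrow> nat \<Rightarrow> nat \<Rightarrow> real"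
    and nabla :: "'a vfield \<Rightarrow> 'a vfield \<Rightarrow> 'a vfield"
  assumes "lie_group G M" and "n = DIM('e)"
    and "left_invariant_metric G M h"
    and "X \<in> lie_algebra G M" and "X \<noteq> 0" and "lie_norm G h X < 1"
    and "left_invariant_metric G M gX"
    and "\<forall>v \<in> lie_algebra G M. \<forall>z \<in> lie_algebra G M.
           lie_inner G gX v z =
             (1 + lie_norm G h X) *
             (lie_inner G h v z + 1 / lie_norm G h X * lie_inner G h X v * lie_inner G h X z)"
    and "\<phi> ` lie_algebra G M \<subseteq> lie_algebra G M" and "linear_on (lie_algebra G M) \<phi>"
    and "\<forall>v \<in> lie_algebra G M. \<forall>z \<in> lie_algebra G M.
           lie_inner G gX v z = lie_inner G h v (\<phi> z)"
    and "inj_on E {1..n}" and "independent (E ` {1..n})"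
    and "span (E ` {1..n}) = lie_algebra G M"
    and "\<forall>i \<in> {1..n}. \<forall>j \<in> {1..n}. lie_inner G h (E i) (E j) = (if i = j then 1 else 0)"
    and "\<forall>i \<in> {1..n}. \<phi> (E i) = lam i *\<^sub>R E i"
    and "\<forall>i \<in> {1..n}. \<forall>j \<in> {1..n}.
           lie_bracket (E i) (E j) = (\<Sum>k = 1..n. \<alpha> i j k *\<^sub>R E k)"
    and "levi_civita M gX nabla"
  shows "\<forall>i \<in> {1..n}. \<forall>j \<in> {1..n}.
      nabla (E i) (E j) =
        (\<Sum>k = 1..n. (1 / 2 * (lam i / lam k * \<alpha> k j i - lam j / lam k * \<alpha> i k j - \<alpha> j i k)) *\<^sub>R E k)
    \<and> nabla (E i) (E j) =
        (\<Sum>k = 1..n.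
          (1 / 2 *
            ((lie_norm G h X + (lie_inner G h X (E i))^2) / (lie_norm G h X + (lie_inner G h X (E k))^2) * \<alpha> k j i
             - (lie_norm G h X + (lie_inner G h X (E j))^2) / (lie_norm G h X + (lie_inner G h X (E k))^2) * \<alpha> i k j
             - \<alpha> j i k)) *\<^sub>R E k)"
proof -
  let ?L = "lie_algebra G M" and ?N = "lie_norm G h X" and ?I = "{1..n}"
  note G = assms(1) and h = assms(3) and X = assms(4) and g = assms(7)
    and orth = assms(15) and \<phi>E = assms(16)
  have grp: "group G" and car: "carrier G = topspace (points M)" and M: "smooth_manifold M"
    using G unfolding lie_group_def by blast+
  have riem: "riemannian_metric M h"
    using h unfolding left_invariant_metric_def by blast
  have sub: "subspace ?L"
    using subspace_span[of "E ` ?I"] unfolding assms(14) .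
  have E: "E k \<in> ?L" if "k \<in> ?I" for k
    using span_base[of "E k" "E ` ?I"] that unfolding assms(14) by simp
  have N: "?N > 0"
    using lie_inner_pos[OF grp car riem X assms(5)] by (simp add: lie_norm_def)
  have g_phi: "lie_inner G gX (E j) (E k) = (if j = k then lam k else 0)"
    if "j \<in> ?I" "k \<in> ?I" for j k
  proof -
    have phi_L: "\<phi> (E k) \<in> ?L"
      using assms(9) E[OF that(2)] by blast
    have "lie_inner G gX (E j) (E k) = lie_inner G h (\<phi> (E k)) (E j)"
      using assms(11) E that lie_inner_sym[OF grp car riem E phi_L] by simp
    also have "\<dots> = lam k * lie_inner G h (E k) (E j)"
      using lie_inner_comb[OF grp car riem E E E, of k k j "lam k" 0] that \<phi>E by simp
    also have "\<dots> = (if j = k then lam k else 0)"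
      using orth that by auto
    finally show ?thesis .
  qed
  have lam: "lam k = (1 + ?N) / ?N * (?N + (lie_inner G h X (E k))\<^sup>2)" if "k \<in> ?I" for k
  proof -
    have "lam k = (1 + ?N) * (lie_inner G h (E k) (E k)
        + 1 / ?N * lie_inner G h X (E k) * lie_inner G h X (E k))"
      using g_phi[OF that that] assms(8) E[OF that] by simp
    then show ?thesis
      using orth that N by (simp add: field_simps power2_eq_square)
  qed
  have pos: "?N + (lie_inner G h X (E k))\<^sup>2 > 0" for k
    using N by (simp add: add_pos_nonneg)
  have lam0: "lam k \<noteq> 0" if "k \<in> ?I" for k
    using lam[OF that] N pos[of k] by auto
  have ext: "\<exists>Y \<in> ?L. u = Y p" if "p \<in> topspace (points M)" "u \<in> tangent_space M p" for p u
    by (rule tangent_space_left_invariant_frame[OF grp car M h sub E _ _ _ that, of ?I])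
      (use orth assms(2) in auto)
  have main: "nabla (E i) (E j) = (\<Sum>k = 1..n. (1 / 2 *
      (lam i / lam k * \<alpha> k j i - lam j / lam k * \<alpha> i k j - \<alpha> j i k)) *\<^sub>R E k)"
    if "i \<in> ?I" "j \<in> ?I" for i j
    by (rule levi_civita_left_invariant_frame[OF G g sub E g_phi lam0 _ assms(14) ext _ assms(18) that])
      (use assms(17) in auto)
  have ratio: "lam i / lam k = (?N + (lie_inner G h X (E i))\<^sup>2) / (?N + (lie_inner G h X (E k))\<^sup>2)"
    if "i \<in> ?I" "k \<in> ?I" for i k
    using lam[OF that(1)] lam[OF that(2)] N by simp
  show ?thesis
    using main ratio by (auto intro!: sum.cong)
qed

end
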